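(* Let $G$ be a finite simple graph and let $\overline{X}_G$ be its Kromatic symmetric function. For each pair of integers $h, k \ge 0$, the number of induced subgraphs of $G$ isomorphic to the disjoint union of an $h$-vertex star graph and $k$ isolated vertices can be recovered from $\overline{X}_G$ (i.e., any two graphs with the same Kromatic symmetric function have the same number of such induced subgraphs).
   Context: All graphs are finite and simple. A star graph is a graph in which one vertex is adjacent to all other vertices and no other pairs of vertices are adjacent; an $h$-vertex star has $h$ vertices. A proper set coloring of $G$ is a function $\kappa: V(G) \to 2^{\mathbb{N}} \setminus \{\varnothing\}$ (where $\mathbb{N}=\{1,2,3,\dots\}$) such that $\kappa(v) \cap \kappa(w) = \varnothing$ whenever $vw \in E(G)$. The Kromatic symmetric function of $G$ is $\overline{X}_G := \sum_{\kappa} \prod_{v \in V(G)} \prod_{i \in \kappa(v)} x_i$, the sum over all proper set colorings $\kappa$ of $G$. *)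

theory Defs
  imports
    "Graph_Theory.Pair_Digraph"
    "Graph_Theory.Digraph_Isomorphism"
    "HOL-Library.Poly_Mapping"
    "HOL-Library.FuncSet"
begin

text \<open>
  A finite simple graph is a \<^locale>\<open>pair_graph\<close>: a finite vertex set with a symmetric,
  loop-free set of arcs, where \<open>(u, v)\<close> and \<open>(v, u)\<close> together represent the edge \<open>uv\<close>.
\<close>

definition proper_set_colorings :: "'a pair_pre_digraph \<Rightarrow> ('a \<Rightarrow> nat set) set" where
  "proper_set_colorings G =
     {\<kappa> \<in> pverts G \<rightarrow>\<^sub>E (Pow {1..} - {{}}). \<forall>(v, w) \<in> parcs G. \<kappa> v \<inter> \<kappa> w = {}}"

text \<open>
  A formal power series in the variables \<open>x\<^sub>1, x\<^sub>2, \<dots>\<close> is given by its coefficients, indexed by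
  the exponent vectors of monomials. The exponent of \<open>x\<^sub>i\<close> in the monomial of a coloring \<open>\<kappa>\<close>
  is the number of vertices \<open>v\<close> with \<open>i \<in> \<kappa> v\<close>. Monomials have finite degree,
  so a coloring that uses an infinite color set contributes to no coefficient.
\<close>

definition kromatic :: "'a pair_pre_digraph \<Rightarrow> (nat \<Rightarrow>\<^sub>0 nat) \<Rightarrow> int" where
  "kromatic G m =
     int (card {\<kappa> \<in> proper_set_colorings G. \<forall>i. Poly_Mapping.lookup m i = card {v \<in> pverts G. i \<in> \<kappa> v}})"

text \<open>For \<open>h = 0\<close> this is the graph without vertices.\<close>

definition star_graph :: "nat \<Rightarrow> nat pair_pre_digraph" where
  "star_graph h = \<lparr> pverts = {..<h},
     parcs = {(u, v). u < h \<and> v < h \<and> u \<noteq> v \<and> (u = 0 \<or> v = 0)} \<rparr>"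

definition edgeless_graph :: "nat \<Rightarrow> nat pair_pre_digraph" where
  "edgeless_graph k = \<lparr> pverts = {..<k}, parcs = {} \<rparr>"

definition disjoint_union ::
  "'a pair_pre_digraph \<Rightarrow> 'b pair_pre_digraph \<Rightarrow> ('a + 'b) pair_pre_digraph" where
  "disjoint_union G H = \<lparr> pverts = pverts G <+> pverts H,
     parcs = map_prod Inl Inl ` parcs G \<union> map_prod Inr Inr ` parcs H \<rparr>"

definition num_induced_copies :: "'b pair_pre_digraph \<Rightarrow> 'a pair_pre_digraph \<Rightarrow> nat" where
  "num_induced_copies F G = card {K :: 'a pair_pre_digraph.
     induced_subgraph (with_proj K) (with_proj G) \<and> digraph_iso (with_proj K) (with_proj F)}"

text \<open>Finiteness facts showing that \<^const>\<open>card\<close> above never falls back to its default value.\<close>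

lemma finite_colorings_of_monomial:
  assumes "pair_graph G"
  shows "finite {\<kappa> \<in> proper_set_colorings G. \<forall>i. Poly_Mapping.lookup m i = card {v \<in> pverts G. i \<in> \<kappa> v}}"
proof (rule finite_subset)
  interpret pair_graph G by fact
  show "finite (pverts G \<rightarrow>\<^sub>E Pow (Poly_Mapping.keys m))"
    by (intro finite_PiE pair_finite_verts) simp
  show "{\<kappa> \<in> proper_set_colorings G. \<forall>i. Poly_Mapping.lookup m i = card {v \<in> pverts G. i \<in> \<kappa> v}}
    \<subseteq> pverts G \<rightarrow>\<^sub>E Pow (Poly_Mapping.keys m)"
  proof
    fix \<kappa> assume "\<kappa> \<in> {\<kappa> \<in> proper_set_colorings G. \<forall>i. Poly_Mapping.lookup m i = card {v \<in> pverts G. i \<in> \<kappa> v}}"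
    then have \<kappa>: "\<kappa> \<in> pverts G \<rightarrow>\<^sub>E (Pow {1..} - {{}})"
      and m: "\<And>i. Poly_Mapping.lookup m i = card {v \<in> pverts G. i \<in> \<kappa> v}"
      by (auto simp: proper_set_colorings_def)
    have "i \<in> Poly_Mapping.keys m" if "v \<in> pverts G" "i \<in> \<kappa> v" for v i
    proof -
      have "finite {v \<in> pverts G. i \<in> \<kappa> v}" using pair_finite_verts by simp
      then have "Poly_Mapping.lookup m i \<noteq> 0" using that m[of i] by auto
      then show ?thesis by (simp add: in_keys_iff)
    qed
    with \<kappa> show "\<kappa> \<in> pverts G \<rightarrow>\<^sub>E Pow (Poly_Mapping.keys m)"
      by (auto simp: PiE_iff)
  qed
qed

lemma finite_induced_copies:
  assumes "pair_graph G"
  shows "finite {K :: 'a pair_pre_digraph.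
    induced_subgraph (with_proj K) (with_proj G) \<and> digraph_iso (with_proj K) (with_proj F)}"
proof (rule finite_subset)
  interpret pair_graph G by fact
  show "finite ((\<lambda>(V, E). \<lparr> pverts = V, parcs = E \<rparr>) ` (Pow (pverts G) \<times> Pow (parcs G)))"
    using pair_finite_verts pair_finite_arcs by simp
  show "{K :: 'a pair_pre_digraph. induced_subgraph (with_proj K) (with_proj G) \<and>
      digraph_iso (with_proj K) (with_proj F)}
    \<subseteq> (\<lambda>(V, E). \<lparr> pverts = V, parcs = E \<rparr>) ` (Pow (pverts G) \<times> Pow (parcs G))"
  proof
    fix K assume "K \<in> {K :: 'a pair_pre_digraph. induced_subgraph (with_proj K) (with_proj G) \<and>
      digraph_iso (with_proj K) (with_proj F)}"
    then have "pverts K \<subseteq> pverts G" "parcs K \<subseteq> parcs G"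
      by (auto simp: induced_subgraph_def subgraph_def)
    moreover have "K = (\<lambda>(V, E). \<lparr> pverts = V, parcs = E \<rparr>) (pverts K, parcs K)"
      by simp
    ultimately show "K \<in> (\<lambda>(V, E). \<lparr> pverts = V, parcs = E \<rparr>) ` (Pow (pverts G) \<times> Pow (parcs G))"
      by blast
  qed
qed

end

theory Submission
  imports Defs
begin

text \<open>
  A coloring with monomial \<open>x\<^sup>m\<close> is the same thing as a family of independent sets \<open>S\<^sub>i\<close> of sizes \<open>m\<^sub>i\<close>
  covering the vertex set \<open>V\<close>. Moebius inversion over the union of the family expresses the coefficient
  of \<open>x\<^sup>m\<close> as the sum over \<open>U \<subseteq> V\<close> of \<open>(-1)\<^bsup>|V - U|\<^esup>\<close> times the product of the numbers of independent
  \<open>m\<^sub>i\<close>-sets in \<open>U\<close>. As \<open>m\<close> varies, these products span all polynomials in the entries of the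
  independence vector of \<open>U\<close>, so distinct vectors can be separated; since the entry at \<open>1\<close> is \<open>|U|\<close>,
  no cancellation occurs among sets with equal vectors. Hence the Kromatic symmetric function
  determines how many induced subgraphs have a given independence vector. Finally, an \<open>n\<close>-vertex graph
  with an independent set of size \<open>n - 1\<close> is a star plus isolated vertices, and the number of
  independent pairs then fixes it up to isomorphism.
\<close>

subsection \<open>Independence vectors\<close>

text \<open>The set \<open>U\<close> stands for the subgraph induced on it, so all induced subgraphs
  can be handled inside one ambient graph.\<close>

definition indep_sets :: "'a pair_pre_digraph \<Rightarrow> 'a set \<Rightarrow> nat \<Rightarrow> 'a set set" where
  "indep_sets G U j = {S. S \<subseteq> U \<and> card S = j \<and> (\<forall>u\<in>S. \<forall>v\<in>S. (u, v) \<notin> parcs G)}"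

text \<open>For finite \<open>U\<close> this is the coefficient sequence of the independence
  polynomial of the subgraph induced on \<open>U\<close>.\<close>

definition indep_vector :: "'a pair_pre_digraph \<Rightarrow> 'a set \<Rightarrow> nat \<Rightarrow> nat" where
  "indep_vector G U j = card (indep_sets G U j)"

lemma finite_indep_sets: "finite U \<Longrightarrow> finite (indep_sets G U j)"
  by (rule finite_subset[of _ "Pow U"]) (auto simp: indep_sets_def)

lemma indep_vector_0 [simp]: "finite U \<Longrightarrow> indep_vector G U 0 = 1"
proof -
  assume "finite U"
  then have "indep_sets G U 0 = {{}}"
    by (auto simp: indep_sets_def dest: finite_subset)
  then show ?thesis by (simp add: indep_vector_def)
qed

lemma indep_vector_empty: "indep_vector G {} j = (if j = 0 then 1 else 0)"
proof -
  have "indep_sets G {} j = (if j = 0 then {{}} else {})"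
    by (auto simp: indep_sets_def)
  then show ?thesis by (simp add: indep_vector_def)
qed

lemma (in pair_loopfree_digraph) loop_notin_parcs [simp]: "(u, u) \<notin> parcs G"
  using pair_no_loops by fastforce

lemma (in pair_loopfree_digraph) indep_vector_1:
  assumes "finite U"
  shows "indep_vector G U 1 = card U"
proof -
  have "indep_sets G U 1 = (\<lambda>u. {u}) ` U"
    by (auto simp: indep_sets_def card_1_singleton_iff)
  then show ?thesis by (simp add: indep_vector_def card_image)
qed

subsection \<open>Coefficients as signed sums over induced subgraphs\<close>

text \<open>Transposing the incidence between vertices and colors is a bijection: properness turns
  into independence of the color classes, and nonempty color sets turn into the covering condition.
  The index 0 has to be absent from \<open>m\<close> because colors are positive.\<close>

lemma kromatic_eq_card_covers:
  assumes "pair_graph G" "0 \<notin> Poly_Mapping.keys m"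
  shows "kromatic G m = int (card {F \<in> \<Pi>\<^sub>E i\<in>Poly_Mapping.keys m.
    indep_sets G (pverts G) (Poly_Mapping.lookup m i). \<Union> (F ` Poly_Mapping.keys m) = pverts G})"
proof -
  interpret pair_graph G by fact
  let ?K = "Poly_Mapping.keys m" and ?m = "Poly_Mapping.lookup m" and ?V = "pverts G"
  let ?C = "{\<kappa> \<in> proper_set_colorings G. \<forall>i. ?m i = card {v \<in> ?V. i \<in> \<kappa> v}}"
  let ?D = "{F \<in> \<Pi>\<^sub>E i\<in>?K. indep_sets G ?V (?m i). \<Union> (F ` ?K) = ?V}"
  let ?f = "\<lambda>\<kappa>. \<lambda>i\<in>?K. {v \<in> ?V. i \<in> \<kappa> v}"
  let ?g = "\<lambda>F. \<lambda>v\<in>?V. {i \<in> ?K. v \<in> F i}"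
  \<comment> \<open>A color that occurs at some vertex has positive exponent, so restricting to the
    support of \<open>m\<close> loses no color.\<close>
  have colors: "i \<in> ?K" if "\<kappa> \<in> ?C" "v \<in> ?V" "i \<in> \<kappa> v" for \<kappa> v i
  proof -
    have "finite {v \<in> ?V. i \<in> \<kappa> v}" using pair_finite_verts by simp
    then have "?m i \<noteq> 0" using that by auto
    then show ?thesis by (simp add: in_keys_iff)
  qed
  have "bij_betw ?f ?C ?D"
  proof (rule bij_betw_byWitness[where f' = ?g])
    show "\<forall>\<kappa>\<in>?C. ?g (?f \<kappa>) = \<kappa>"
    proof
      fix \<kappa> assume \<kappa>: "\<kappa> \<in> ?C"
      then have ext: "\<kappa> \<in> extensional ?V"
        by (auto simp: proper_set_colorings_def PiE_iff)
      show "?g (?f \<kappa>) = \<kappa>"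
      proof (rule extensionalityI[OF _ ext])
        fix v assume "v \<in> ?V"
        then show "?g (?f \<kappa>) v = \<kappa> v" using colors[OF \<kappa>] by auto
      qed simp
    qed
    show "\<forall>F\<in>?D. ?f (?g F) = F"
    proof
      fix F assume F: "F \<in> ?D"
      then have ext: "F \<in> extensional ?K" and sub: "\<And>i. i \<in> ?K \<Longrightarrow> F i \<subseteq> ?V"
        by (auto simp: PiE_iff indep_sets_def)
      show "?f (?g F) = F"
      proof (rule extensionalityI[OF _ ext])
        fix i assume "i \<in> ?K"
        then show "?f (?g F) i = F i" using sub by auto
      qed simp
    qed
    show "?f ` ?C \<subseteq> ?D"
    proof
      fix F assume "F \<in> ?f ` ?C"
      then obtain \<kappa> where \<kappa>: "\<kappa> \<in> ?C" and F: "F = ?f \<kappa>" by blast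
      have "(u, v) \<notin> parcs G" if "i \<in> \<kappa> u" "i \<in> \<kappa> v" for i u v
        using \<kappa> that by (auto simp: proper_set_colorings_def)
      then have "?f \<kappa> \<in> (\<Pi>\<^sub>E i\<in>?K. indep_sets G ?V (?m i))"
        using \<kappa> by (auto simp: indep_sets_def)
      moreover have "\<exists>i. i \<in> \<kappa> v" if "v \<in> ?V" for v
        using \<kappa> that by (fastforce simp: proper_set_colorings_def PiE_iff)
      then have "\<Union> (?f \<kappa> ` ?K) = ?V"
        using colors[OF \<kappa>] by fastforce
      ultimately show "F \<in> ?D" using F by simp
    qed
    show "?g ` ?D \<subseteq> ?C"
    proof
      fix \<kappa> assume "\<kappa> \<in> ?g ` ?D"
      then obtain F where F: "F \<in> ?D" and \<kappa>: "\<kappa> = ?g F" by blast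
      have sub: "F i \<subseteq> ?V" "card (F i) = ?m i" "\<And>u v. u \<in> F i \<Longrightarrow> v \<in> F i \<Longrightarrow> (u, v) \<notin> parcs G"
        if "i \<in> ?K" for i
        using F that by (auto simp: PiE_iff indep_sets_def)
      have "\<exists>i\<in>?K. v \<in> F i" if "v \<in> ?V" for v
        using F that by auto
      moreover have "?K \<subseteq> {1..}"
        using assms(2) by (auto simp: Suc_le_eq intro!: gr0I)
      ultimately have "?g F \<in> ?V \<rightarrow>\<^sub>E (Pow {1..} - {{}})"
        by fastforce
      moreover have "?g F u \<inter> ?g F v = {}" if "(u, v) \<in> parcs G" for u v
        using that sub(3) in_arcsD1[OF that] in_arcsD2[OF that] by auto
      ultimately have "?g F \<in> proper_set_colorings G"
        unfolding proper_set_colorings_def by blast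
      moreover have "?m i = card {v \<in> ?V. i \<in> ?g F v}" for i
      proof (cases "i \<in> ?K")
        case True
        then have "{v \<in> ?V. i \<in> ?g F v} = F i" using sub(1) by auto
        then show ?thesis using sub(2) True by simp
      next
        case False
        then have "{v \<in> ?V. i \<in> ?g F v} = {}" by auto
        then show ?thesis using False by (simp only: in_keys_iff) simp
      qed
      ultimately show "\<kappa> \<in> ?C" using \<kappa> by blast
    qed
  qed
  then show ?thesis by (simp add: kromatic_def bij_betw_same_card)
qed

lemma kromatic_eq_signed_sum:
  assumes "pair_graph G" "0 \<notin> Poly_Mapping.keys m"
  shows "kromatic G m = (\<Sum>U\<in>Pow (pverts G). (-1) ^ (card (pverts G) - card U) *
    (\<Prod>i\<in>Poly_Mapping.keys m. int (indep_vector G U (Poly_Mapping.lookup m i))))"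
proof -
  interpret pair_graph G by fact
  let ?K = "Poly_Mapping.keys m" and ?m = "Poly_Mapping.lookup m"
  let ?fam = "\<lambda>S. \<Pi>\<^sub>E i\<in>?K. indep_sets G S (?m i)"
  let ?cov = "\<lambda>S. {F \<in> ?fam S. \<Union> (F ` ?K) = S}"
  \<comment> \<open>The product counts all families of independent subsets of \<open>S\<close>.
    Sorting them by their union gives a sum over the subset lattice, which is then inverted.\<close>
  have "(\<Prod>i\<in>?K. int (indep_vector G S (?m i))) = (\<Sum>T\<in>Pow S. int (card (?cov T)))"
    if "finite S" for S
  proof -
    have fin: "finite (?fam S)"
      using that by (intro finite_PiE finite_indep_sets) auto
    \<comment> \<open>The members of a family lie in its union \<open>T\<close>, so it does not
      matter whether they are drawn from \<open>T\<close> or from \<open>S\<close>.\<close>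
    have cov: "?cov T = {F \<in> ?fam S. \<Union> (F ` ?K) = T}" if "T \<subseteq> S" for T
    proof -
      have "F i \<in> indep_sets G T n \<longleftrightarrow> F i \<in> indep_sets G S n"
        if "\<Union> (F ` ?K) = T" "i \<in> ?K" for F i n
        using that \<open>T \<subseteq> S\<close> by (auto simp: indep_sets_def)
      then show ?thesis unfolding PiE_iff by blast
    qed
    have "(\<Prod>i\<in>?K. int (indep_vector G S (?m i))) = int (card (?fam S))"
      by (simp add: card_PiE indep_vector_def)
    also have "\<dots> = (\<Sum>F\<in>?fam S. 1)" by simp
    also have "\<dots> = (\<Sum>T\<in>Pow S. \<Sum>F\<in>{F \<in> ?fam S. \<Union> (F ` ?K) = T}. 1)"
      using fin that
      by (intro sum.group[symmetric]) (auto simp: PiE_iff indep_sets_def)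
    also have "\<dots> = (\<Sum>T\<in>Pow S. int (card (?cov T)))"
      by (intro sum.cong refl) (simp add: cov)
    finally show ?thesis .
  qed
  from inclusion_exclusion_mobius[OF this pair_finite_verts] show ?thesis
    by (simp only: kromatic_eq_card_covers[OF assms])
qed

subsection \<open>Separating vectors by monomials\<close>

text \<open>Each factor is a coordinate minus a constant. Multiplying by a coordinate amounts to
  adding one more variable to the monomial, hence the induction over \<open>B\<close> with
  \<open>m\<close> arbitrary. A coordinate \<open>j b\<close> can be an exponent of a variable in
  the support only if it is nonzero.\<close>

lemma shifted_monomial_sums_eq:
  fixes x :: "'i \<Rightarrow> nat \<Rightarrow> nat" and y :: "'j \<Rightarrow> nat \<Rightarrow> nat" and v :: "'i \<Rightarrow> int" and w :: "'j \<Rightarrow> int"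
    and m :: "nat \<Rightarrow>\<^sub>0 nat"
  assumes monomials: "\<And>m :: nat \<Rightarrow>\<^sub>0 nat. 0 \<notin> Poly_Mapping.keys m \<Longrightarrow>
      (\<Sum>s\<in>S. v s * (\<Prod>i\<in>Poly_Mapping.keys m. int (x s (Poly_Mapping.lookup m i))))
    = (\<Sum>t\<in>T. w t * (\<Prod>i\<in>Poly_Mapping.keys m. int (y t (Poly_Mapping.lookup m i))))"
    and "finite B" "\<And>b. b \<in> B \<Longrightarrow> j b \<noteq> 0" "0 \<notin> Poly_Mapping.keys m"
  shows "(\<Sum>s\<in>S. v s * (\<Prod>i\<in>Poly_Mapping.keys m. int (x s (Poly_Mapping.lookup m i))) *
            (\<Prod>b\<in>B. int (x s (j b)) - c b))
       = (\<Sum>t\<in>T. w t * (\<Prod>i\<in>Poly_Mapping.keys m. int (y t (Poly_Mapping.lookup m i))) *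
            (\<Prod>b\<in>B. int (y t (j b)) - c b))"
  using assms(2-)
proof (induction B arbitrary: m rule: finite_induct)
  case empty
  then show ?case using monomials[of m] by simp
next
  case (insert b B)
  \<comment> \<open>A fresh variable \<open>k\<close> with exponent \<open>j b\<close> contributes
    exactly the factor \<open>z (j b)\<close>; it differs from 0 so that the hypothesis on monomials
    still applies.\<close>
  obtain k where k: "k \<notin> insert 0 (Poly_Mapping.keys m)"
    by (meson ex_new_if_finite finite_insert finite_keys infinite_UNIV_nat)
  define m' where "m' = Poly_Mapping.update k (j b) m"
  have keys: "Poly_Mapping.keys m' = insert k (Poly_Mapping.keys m)"
    using insert.prems(1)[of b] by (simp add: m'_def keys_update)
  have prod: "(\<Prod>i\<in>Poly_Mapping.keys m'. int (z (Poly_Mapping.lookup m' i)))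
      = int (z (j b)) * (\<Prod>i\<in>Poly_Mapping.keys m. int (z (Poly_Mapping.lookup m i)))" for z
  proof -
    have "(\<Prod>i\<in>Poly_Mapping.keys m. int (z (Poly_Mapping.lookup m' i)))
        = (\<Prod>i\<in>Poly_Mapping.keys m. int (z (Poly_Mapping.lookup m i)))"
      using k by (intro prod.cong) (auto simp: m'_def lookup_update)
    then show ?thesis
      using k by (simp add: keys) (simp add: m'_def lookup_update)
  qed
  \<comment> \<open>Expanding the factor of \<open>b\<close> leaves two sums over \<open>B\<close>,
    one for \<open>m'\<close> and one for \<open>m\<close>. The index type is generic because both
    sides of the goal are rewritten.\<close>
  have split: "(\<Sum>s\<in>A. u s * (\<Prod>i\<in>Poly_Mapping.keys m. int (z s (Poly_Mapping.lookup m i))) *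
        (\<Prod>b\<in>insert b B. int (z s (j b)) - c b))
      = (\<Sum>s\<in>A. u s * (\<Prod>i\<in>Poly_Mapping.keys m'. int (z s (Poly_Mapping.lookup m' i))) *
          (\<Prod>b\<in>B. int (z s (j b)) - c b))
      - c b * (\<Sum>s\<in>A. u s * (\<Prod>i\<in>Poly_Mapping.keys m. int (z s (Poly_Mapping.lookup m i))) *
          (\<Prod>b\<in>B. int (z s (j b)) - c b))" for A :: "'k set" and u z
    using insert.hyps
    by (simp add: prod sum_distrib_left sum_subtractf[symmetric] algebra_simps)
  have "0 \<notin> Poly_Mapping.keys m'" using k keys insert.prems by auto
  then show ?case
    unfolding split using insert.IH insert.prems by simp
qed

text \<open>Interpolation: a product of linear factors that vanishes at every occurring vector other
  than \<open>a\<close>, but not at \<open>a\<close>, isolates the fiber over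
  \<open>a\<close>.\<close>

lemma sum_fiber_eq_if_monomial_sums_eq:
  fixes x :: "'i \<Rightarrow> nat \<Rightarrow> nat" and y :: "'j \<Rightarrow> nat \<Rightarrow> nat" and v :: "'i \<Rightarrow> int" and w :: "'j \<Rightarrow> int"
  assumes fin: "finite S" "finite T"
    and zero: "\<And>s. s \<in> S \<Longrightarrow> x s 0 = 1" "\<And>t. t \<in> T \<Longrightarrow> y t 0 = 1"
    and monomials: "\<And>m :: nat \<Rightarrow>\<^sub>0 nat. 0 \<notin> Poly_Mapping.keys m \<Longrightarrow>
      (\<Sum>s\<in>S. v s * (\<Prod>i\<in>Poly_Mapping.keys m. int (x s (Poly_Mapping.lookup m i))))
    = (\<Sum>t\<in>T. w t * (\<Prod>i\<in>Poly_Mapping.keys m. int (y t (Poly_Mapping.lookup m i))))"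
  shows "(\<Sum>s | s \<in> S \<and> x s = a. v s) = (\<Sum>t | t \<in> T \<and> y t = a. w t)"
proof (cases "a 0 = 1")
  case False
  then have empty: "{s. s \<in> S \<and> x s = a} = {}" "{t. t \<in> T \<and> y t = a} = {}"
    using zero by auto
  show ?thesis unfolding empty by simp
next
  case True
  \<comment> \<open>Vectors from both sides are collected, so that a single polynomial serves both
    sums.\<close>
  define B where "B = (x ` S \<union> y ` T) - {a}"
  define j where "j b = (SOME j. b j \<noteq> a j)" for b
  have j: "b (j b) \<noteq> a (j b)" if "b \<in> B" for b
  proof -
    have "b \<noteq> a" using that by (simp add: B_def)
    then have "\<exists>j. b j \<noteq> a j" by blast
    then show ?thesis unfolding j_def by (rule someI_ex)
  qed
  \<comment> \<open>All vectors have entry 1 at 0, so a coordinate that tells two of them apart is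
    positive and may serve as an exponent.\<close>
  have j0: "j b \<noteq> 0" if "b \<in> B" for b
  proof
    assume "j b = 0"
    moreover have "b 0 = 1" using that zero by (auto simp: B_def)
    ultimately show False using j[OF that] True by simp
  qed
  have "finite B" using fin by (simp add: B_def)
  let ?p = "\<lambda>z. \<Prod>b\<in>B. int (z (j b)) - int (b (j b))"
  have "?p a \<noteq> 0" using j \<open>finite B\<close> by force
  have vanish: "?p b = 0" if "b \<in> B" for b
    using that \<open>finite B\<close> by (auto intro: prod_zero)
  have fiber: "(\<Sum>s\<in>A. u s * ?p (z s)) = (\<Sum>s | s \<in> A \<and> z s = a. u s) * ?p a"
    if "finite A" "z ` A - {a} \<subseteq> B" for A :: "'k set" and u z
  proof -
    have "(\<Sum>s\<in>A. u s * ?p (z s)) = (\<Sum>s | s \<in> A \<and> z s = a. u s * ?p (z s))"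
      using that vanish by (intro sum.mono_neutral_right) auto
    then show ?thesis by (simp add: sum_distrib_right)
  qed
  have "(\<Sum>s\<in>S. v s * ?p (x s)) = (\<Sum>t\<in>T. w t * ?p (y t))"
    using shifted_monomial_sums_eq[OF monomials \<open>finite B\<close> j0, where m = 0 and c = "\<lambda>b. int (b (j b))"]
    by simp
  moreover have "x ` S - {a} \<subseteq> B" "y ` T - {a} \<subseteq> B" by (auto simp: B_def)
  ultimately show ?thesis
    using fiber[of S x v] fiber[of T y w] fin \<open>?p a \<noteq> 0\<close> by simp
qed

section \<open>Equidistribution of independence vectors\<close>

text \<open>Separation is applied to the signed sums over vertex subsets. All subsets with vector
  \<open>a\<close> have size \<open>a 1\<close>, so they carry the same sign, and each fiber sum is
  a cardinality up to sign.\<close>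

theorem card_indep_vector_fiber_eq:
  assumes G: "pair_graph G" and H: "pair_graph H" and eq: "kromatic G = kromatic H"
  shows "card {U. U \<subseteq> pverts G \<and> indep_vector G U = a} = card {U. U \<subseteq> pverts H \<and> indep_vector H U = a}"
proof -
  interpret G: pair_graph G by fact
  interpret H: pair_graph H by fact
  let ?n = "\<lambda>a. int (card {U. U \<subseteq> pverts G \<and> indep_vector G U = a})"
  let ?n' = "\<lambda>a. int (card {U. U \<subseteq> pverts H \<and> indep_vector H U = a})"
  have fin: "finite U" if "U \<subseteq> pverts G" for U by (rule finite_subset[OF that G.pair_finite_verts])
  have fin': "finite U" if "U \<subseteq> pverts H" for U by (rule finite_subset[OF that H.pair_finite_verts])
  have "(\<Sum>U | U \<in> Pow (pverts G) \<and> indep_vector G U = a. (-1) ^ (card (pverts G) - card U))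
      = (\<Sum>U | U \<in> Pow (pverts H) \<and> indep_vector H U = a. (-1) ^ (card (pverts H) - card U) :: int)" for a
    by (rule sum_fiber_eq_if_monomial_sums_eq)
      (simp_all add: fin fin' G.pair_finite_verts H.pair_finite_verts eq
        flip: kromatic_eq_signed_sum[OF G] kromatic_eq_signed_sum[OF H])
  moreover have "(\<Sum>U | U \<in> Pow (pverts G) \<and> indep_vector G U = a. (-1) ^ (card (pverts G) - card U))
      = (-1) ^ (card (pverts G) + a 1) * ?n a" for a
  proof -
    \<comment> \<open>Since \<open>card U\<close> is at most the order of \<open>G\<close>, the
      subtraction is not truncated, and difference and sum have the same parity.\<close>
    have "(-1::int) ^ (card (pverts G) - card U) = (-1) ^ (card (pverts G) + a 1)"
      if "U \<subseteq> pverts G" "indep_vector G U = a" for U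
      using that G.indep_vector_1[OF fin, of U] card_mono[OF G.pair_finite_verts, of U]
      by (auto simp: minus_one_power_iff)
    then show ?thesis by simp
  qed
  moreover have "(\<Sum>U | U \<in> Pow (pverts H) \<and> indep_vector H U = a. (-1) ^ (card (pverts H) - card U))
      = (-1) ^ (card (pverts H) + a 1) * ?n' a" for a
  proof -
    have "(-1::int) ^ (card (pverts H) - card U) = (-1) ^ (card (pverts H) + a 1)"
      if "U \<subseteq> pverts H" "indep_vector H U = a" for U
      using that H.indep_vector_1[OF fin', of U] card_mono[OF H.pair_finite_verts, of U]
      by (auto simp: minus_one_power_iff)
    then show ?thesis by simp
  qed
  ultimately have signed: "(-1) ^ (card (pverts G) + a 1) * ?n a = (-1) ^ (card (pverts H) + a 1) * ?n' a" for a
    by simp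
  \<comment> \<open>The empty subgraph has a vector of its own, which shows that both orders have the same parity.\<close>
  have e: "{U. U \<subseteq> pverts G \<and> indep_vector G U = indep_vector G {}} = {{}}"
    using G.indep_vector_1[OF fin] G.indep_vector_1[of "{}"] fin by (auto dest!: fun_cong[where x = 1])
  have "indep_vector G {} = indep_vector H {}"
    by (simp add: indep_vector_empty fun_eq_iff)
  then have e': "{U. U \<subseteq> pverts H \<and> indep_vector H U = indep_vector G {}} = {{}}"
    using H.indep_vector_1[OF fin'] H.indep_vector_1[of "{}"] fin' by (auto dest!: fun_cong[where x = 1])
  have "(-1 :: int) ^ (card (pverts G)) = (-1) ^ (card (pverts H))"
    using signed[of "indep_vector G {}"] by (simp add: e e' power_add)
  then have "?n a = ?n' a"
    using signed[of a] by (simp add: power_add)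
  then show ?thesis by simp
qed

subsection \<open>Graphs with an independent set missing one vertex\<close>

definition induced :: "'a pair_pre_digraph \<Rightarrow> 'a set \<Rightarrow> 'a pair_pre_digraph" where
  "induced G U = \<lparr> pverts = U, parcs = parcs G \<inter> U \<times> U \<rparr>"

lemma induced_simps [simp]: "pverts (induced G U) = U" "parcs (induced G U) = parcs G \<inter> U \<times> U"
  by (simp_all add: induced_def)

lemma indep_vector_induced [simp]: "indep_vector (induced G U) U = indep_vector G U"
proof -
  have "indep_sets (induced G U) U j = indep_sets G U j" for j
    by (auto simp: indep_sets_def)
  then show ?thesis by (simp add: indep_vector_def fun_eq_iff)
qed

lemma pair_graph_induced:
  assumes "pair_graph G" "U \<subseteq> pverts G"
  shows "pair_graph (induced G U)"
proof -
  interpret pair_graph G by fact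
  show ?thesis
    using assms(2) pair_finite_verts pair_finite_arcs
    by unfold_locales (auto simp: symmetric_def intro!: symI intro: finite_subset arcs_symmetric)
qed

text \<open>An induced subgraph is determined by its vertex set, so copies can be counted as vertex
  sets.\<close>

lemma num_induced_copies_eq:
  assumes "pair_graph G"
  shows "num_induced_copies F G
    = card {U. U \<subseteq> pverts G \<and> digraph_iso (with_proj (induced G U)) (with_proj F)}"
proof -
  interpret pair_graph G by fact
  have "induced_subgraph (with_proj K) (with_proj G)
      \<longleftrightarrow> (\<exists>U. U \<subseteq> pverts G \<and> K = induced G U)" for K :: "'a pair_pre_digraph"
  proof
    assume "induced_subgraph (with_proj K) (with_proj G)"
    then have "pverts K \<subseteq> pverts G" "parcs K = parcs G \<inter> pverts K \<times> pverts K"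
      by (auto simp: induced_subgraph_def subgraph_def)
    then show "\<exists>U. U \<subseteq> pverts G \<and> K = induced G U"
      by (intro exI[of _ "pverts K"]) (auto simp: induced_def)
  next
    assume "\<exists>U. U \<subseteq> pverts G \<and> K = induced G U"
    then obtain U where U: "U \<subseteq> pverts G" "K = induced G U" by blast
    then interpret K: pair_graph K using pair_graph_induced[OF assms] by simp
    have "wf_digraph (with_proj K)" "wf_digraph (with_proj G)" by unfold_locales
    then show "induced_subgraph (with_proj K) (with_proj G)"
      using U by (auto simp: induced_subgraph_def subgraph_def compatible_def)
  qed
  then have "{K. induced_subgraph (with_proj K) (with_proj G) \<and> digraph_iso (with_proj K) (with_proj F)}
      = induced G ` {U. U \<subseteq> pverts G \<and> digraph_iso (with_proj (induced G U)) (with_proj F)}"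
    by auto
  moreover have "inj_on (induced G) A" for A
    by (rule inj_onI) (simp add: induced_def)
  ultimately show ?thesis
    by (simp add: num_induced_copies_def card_image)
qed

text \<open>Reduces the general notion, which carries separate maps for vertices, arcs, tails and
  heads, to a vertex bijection that preserves and reflects adjacency.\<close>

lemma digraph_iso_with_proj_iff:
  assumes "pair_wf_digraph G" "pair_wf_digraph H"
  shows "digraph_iso (with_proj G) (with_proj H) \<longleftrightarrow> (\<exists>f. bij_betw f (pverts G) (pverts H) \<and>
    (\<forall>u\<in>pverts G. \<forall>v\<in>pverts G. (f u, f v) \<in> parcs H \<longleftrightarrow> (u, v) \<in> parcs G))"
proof
  interpret G: pair_wf_digraph G by fact
  assume "digraph_iso (with_proj G) (with_proj H)"
  then obtain f where f: "pre_digraph.digraph_isomorphism (with_proj G) f"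
    and H: "with_proj H = app_iso f (with_proj G)"
    by (auto simp: digraph_iso_def)
  have "verts (with_proj H) = iso_verts f ` pverts G" "arcs (with_proj H) = iso_arcs f ` parcs G"
    "tail (with_proj H) = iso_tail f" "head (with_proj H) = iso_head f"
    by (simp_all only: H app_iso_simps with_proj_simps)
  then have H': "pverts H = iso_verts f ` pverts G" "parcs H = iso_arcs f ` parcs G"
    "iso_tail f = fst" "iso_head f = snd"
    by simp_all
  \<comment> \<open>In \<open>H\<close> tails and heads are the pair projections, so compatibility
    with them forces the arc map to act componentwise by the vertex map.\<close>
  have arcs: "iso_arcs f (u, v) = (iso_verts f u, iso_verts f v)" if "(u, v) \<in> parcs G" for u v
    using f that by (auto simp: pre_digraph.digraph_isomorphism_def H' prod_eq_iff)
  have inj: "inj_on (iso_verts f) (pverts G)"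
    using f by (auto simp: pre_digraph.digraph_isomorphism_def)
  have "(iso_verts f u, iso_verts f v) \<in> parcs H \<longleftrightarrow> (u, v) \<in> parcs G"
    if uv: "u \<in> pverts G" "v \<in> pverts G" for u v
  proof
    assume "(iso_verts f u, iso_verts f v) \<in> parcs H"
    then obtain u' v' where "(u', v') \<in> parcs G" "iso_arcs f (u', v') = (iso_verts f u, iso_verts f v)"
      unfolding H' by fastforce
    then show "(u, v) \<in> parcs G"
      using arcs uv inj G.in_arcsD1 G.in_arcsD2 by (metis inj_onD prod.inject)
  next
    assume "(u, v) \<in> parcs G"
    then show "(iso_verts f u, iso_verts f v) \<in> parcs H"
      using arcs H' by (metis imageI)
  qed
  then show "\<exists>f. bij_betw f (pverts G) (pverts H) \<and>
    (\<forall>u\<in>pverts G. \<forall>v\<in>pverts G. (f u, f v) \<in> parcs H \<longleftrightarrow> (u, v) \<in> parcs G)"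
    using inj H' by (intro exI[of _ "iso_verts f"]) (auto simp: bij_betw_def)
next
  interpret G: pair_wf_digraph G by fact
  interpret H: pair_wf_digraph H by fact
  assume "\<exists>f. bij_betw f (pverts G) (pverts H) \<and>
    (\<forall>u\<in>pverts G. \<forall>v\<in>pverts G. (f u, f v) \<in> parcs H \<longleftrightarrow> (u, v) \<in> parcs G)"
  then obtain f where bij: "bij_betw f (pverts G) (pverts H)"
    and f: "\<And>u v. u \<in> pverts G \<Longrightarrow> v \<in> pverts G \<Longrightarrow> (f u, f v) \<in> parcs H \<longleftrightarrow> (u, v) \<in> parcs G"
    by blast
  let ?f = "\<lparr> iso_verts = f, iso_arcs = map_prod f f, iso_head = snd, iso_tail = fst \<rparr>"
  have inj: "inj_on f (pverts G)" and im: "f ` pverts G = pverts H"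
    using bij by (auto simp: bij_betw_def)
  have "inj_on (map_prod f f) (pverts G \<times> pverts G)"
    using inj by (rule map_prod_inj_on) (rule inj)
  then have "inj_on (map_prod f f) (parcs G)"
    by (rule inj_on_subset) (auto dest: G.in_arcsD1 G.in_arcsD2)
  then have "pre_digraph.digraph_isomorphism (with_proj G) ?f"
    using inj G.wf_digraph_axioms by (auto simp: pre_digraph.digraph_isomorphism_def)
  moreover have "parcs H = map_prod f f ` parcs G"
  proof (intro equalityI subsetI)
    fix e assume e: "e \<in> parcs H"
    then have "fst e \<in> f ` pverts G" "snd e \<in> f ` pverts G"
      unfolding im by (simp_all add: H.arc_fst_in_verts H.arc_snd_in_verts)
    then obtain u v where "u \<in> pverts G" "v \<in> pverts G" "e = (f u, f v)"
      by (metis imageE prod.collapse)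
    then show "e \<in> map_prod f f ` parcs G"
      using e f by (auto intro!: rev_image_eqI)
  qed (use f in \<open>auto dest: G.in_arcsD1 G.in_arcsD2\<close>)
  then have "with_proj H = app_iso ?f (with_proj G)"
    by (simp add: with_proj_def app_iso_def im)
  ultimately show "digraph_iso (with_proj G) (with_proj H)"
    unfolding digraph_iso_def by blast
qed

lemma indep_vector_eq_if_iso:
  assumes bij: "bij_betw f (pverts G) (pverts H)"
    and f: "\<forall>u\<in>pverts G. \<forall>v\<in>pverts G. (f u, f v) \<in> parcs H \<longleftrightarrow> (u, v) \<in> parcs G"
  shows "indep_vector G (pverts G) = indep_vector H (pverts H)"
proof
  fix j
  have inj: "inj_on f (pverts G)" and im: "f ` pverts G = pverts H"
    using bij by (auto simp: bij_betw_def)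
  have card: "card (f ` S) = card S" if "S \<subseteq> pverts G" for S
    using inj that by (meson card_image inj_on_subset)
  have "bij_betw ((`) f) (indep_sets G (pverts G) j) (indep_sets H (pverts H) j)"
  proof (rule bij_betw_imageI)
    show "inj_on ((`) f) (indep_sets G (pverts G) j)"
      by (rule inj_on_subset[OF inj_on_image_Pow[OF inj]]) (auto simp: indep_sets_def)
    show "(`) f ` indep_sets G (pverts G) j = indep_sets H (pverts H) j"
    proof (intro equalityI subsetI)
      fix S assume "S \<in> (`) f ` indep_sets G (pverts G) j"
      then obtain R where R: "R \<in> indep_sets G (pverts G) j" "S = f ` R" by blast
      then have "R \<subseteq> pverts G" by (simp add: indep_sets_def)
      moreover from this have "S \<subseteq> pverts H" using im R(2) by blast
      ultimately show "S \<in> indep_sets H (pverts H) j"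
        using R f card[of R] by (auto simp: indep_sets_def subset_iff)
    next
      fix S assume S: "S \<in> indep_sets H (pverts H) j"
      then have "S \<subseteq> f ` pverts G" by (auto simp: indep_sets_def im)
      then obtain R where R: "R \<subseteq> pverts G" "S = f ` R" by (auto simp: subset_image_iff)
      then have "R \<in> indep_sets G (pverts G) j"
        using S f card[of R] by (auto simp: indep_sets_def subset_iff)
      then show "S \<in> (`) f ` indep_sets G (pverts G) j" using R by blast
    qed
  qed
  then show "indep_vector G (pverts G) j = indep_vector H (pverts H) j"
    by (simp add: indep_vector_def bij_betw_same_card)
qed

section \<open>Reconstruction of star-like graphs from their vectors\<close>

text \<open>Every pair inside \<open>S\<close> is independent, and a pair through \<open>c\<close>
  is independent exactly when its other end is a non-neighbour of \<open>c\<close>. Thus the entry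
  at 2 reveals the degree of \<open>c\<close>.\<close>

lemma (in pair_graph) indep_vector_2_insert:
  assumes "finite S" "c \<notin> S" and S: "\<forall>u\<in>S. \<forall>v\<in>S. (u, v) \<notin> parcs G"
  shows "indep_vector G (insert c S) 2 = (card S choose 2) + card {s \<in> S. (c, s) \<notin> parcs G}"
proof -
  let ?A = "{R. R \<subseteq> S \<and> card R = 2}" and ?B = "(\<lambda>s. {c, s}) ` {s \<in> S. (c, s) \<notin> parcs G}"
  have "indep_sets G (insert c S) 2 = ?A \<union> ?B"
  proof (intro equalityI subsetI)
    fix R assume R: "R \<in> indep_sets G (insert c S) 2"
    show "R \<in> ?A \<union> ?B"
    proof (cases "c \<in> R")
      case True
      then obtain s where "R = {c, s}" "s \<noteq> c"
        using R by (auto simp: indep_sets_def card_2_iff)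
      then show ?thesis using R by (auto simp: indep_sets_def)
    next
      case False
      then show ?thesis using R by (auto simp: indep_sets_def)
    qed
  next
    fix R assume "R \<in> ?A \<union> ?B"
    then show "R \<in> indep_sets G (insert c S) 2"
      using S \<open>c \<notin> S\<close>
      by (auto simp: indep_sets_def card_2_iff subset_iff dest: arcs_symmetric)
  qed
  moreover have "?A \<inter> ?B = {}" using \<open>c \<notin> S\<close> by auto
  moreover have "inj_on (\<lambda>s. {c, s}) {s \<in> S. (c, s) \<notin> parcs G}"
    by (auto simp: inj_on_def doubleton_eq_iff)
  ultimately show ?thesis
    using \<open>finite S\<close> by (simp add: indep_vector_def card_Un_disjoint card_image n_subsets)
qed

text \<open>The entries at 1 and at \<open>card S\<close> yield an independent set \<open>R\<close>
  of \<open>G\<close> that misses a single vertex \<open>d\<close>. All edges then pass through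
  \<open>d\<close>, so the number of its non-neighbours, read off from the entry at 2, determines
  the graph up to isomorphism.\<close>

lemma iso_if_indep_vector_eq:
  assumes G: "pair_graph G" and F: "pair_graph F"
    and eq: "indep_vector G (pverts G) = indep_vector F (pverts F)"
    and VF: "pverts F = insert c S" "c \<notin> S" and S: "\<forall>u\<in>S. \<forall>v\<in>S. (u, v) \<notin> parcs F"
  obtains f where "bij_betw f (pverts G) (pverts F)"
    "\<forall>u\<in>pverts G. \<forall>v\<in>pverts G. (f u, f v) \<in> parcs F \<longleftrightarrow> (u, v) \<in> parcs G"
proof -
  interpret G: pair_graph G by fact
  interpret F: pair_graph F by fact
  have finS: "finite S" using F.pair_finite_verts VF by simp
  have "card (pverts G) = card (pverts F)"
    using fun_cong[OF eq, of 1] G.indep_vector_1 F.indep_vector_1 G.pair_finite_verts F.pair_finite_verts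
    by simp
  then have cardG: "card (pverts G) = Suc (card S)" using VF finS by simp
  \<comment> \<open>The set \<open>S\<close> itself makes the entry at \<open>card S\<close>
    nonzero, and this transfers to \<open>G\<close>.\<close>
  have "S \<in> indep_sets F (pverts F) (card S)" using VF S by (auto simp: indep_sets_def)
  then have "indep_vector F (pverts F) (card S) \<noteq> 0"
    using finite_indep_sets[OF F.pair_finite_verts] by (auto simp: indep_vector_def)
  then have "indep_sets G (pverts G) (card S) \<noteq> {}"
    unfolding eq[symmetric] by (auto simp: indep_vector_def)
  then obtain R where R: "R \<subseteq> pverts G" "card R = card S" "\<forall>u\<in>R. \<forall>v\<in>R. (u, v) \<notin> parcs G"
    by (auto simp: indep_sets_def)
  have finR: "finite R" using R(1) G.pair_finite_verts finite_subset by blast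
  have "card (pverts G - R) = 1" using card_Diff_subset[OF finR R(1)] cardG R(2) by simp
  then obtain d where "pverts G - R = {d}" by (auto simp: card_1_singleton_iff)
  then have VG: "pverts G = insert d R" "d \<notin> R" using R(1) by auto
  let ?M = "{s \<in> R. (d, s) \<notin> parcs G}" and ?M' = "{s \<in> S. (c, s) \<notin> parcs F}"
  let ?N = "{s \<in> R. (d, s) \<in> parcs G}" and ?N' = "{s \<in> S. (c, s) \<in> parcs F}"
  \<comment> \<open>The binomial coefficients in the two entries cancel because \<open>R\<close> and
    \<open>S\<close> have equal size.\<close>
  have M: "card ?M = card ?M'"
    using fun_cong[OF eq, of 2] VG VF R S finR finS
    by (simp add: G.indep_vector_2_insert F.indep_vector_2_insert)
  have "card ?M + card ?N = card R" "card ?M' + card ?N' = card S"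
    using finR finS by (subst card_Un_disjoint[symmetric]; auto intro: arg_cong[where f = card])+
  then have N: "card ?N = card ?N'" using M R(2) by simp
  obtain f g where f: "bij_betw f ?M ?M'" and g: "bij_betw g ?N ?N'"
    using finite_same_card_bij[of ?M ?M'] finite_same_card_bij[of ?N ?N'] M N finR finS by auto
  \<comment> \<open>Any bijection matching \<open>d\<close> with \<open>c\<close>, non-neighbours
    with non-neighbours and neighbours with neighbours is an isomorphism.\<close>
  define k where "k u = (if u = d then c else if u \<in> ?M then f u else g u)" for u
  have kM: "bij_betw k ?M ?M'"
    using f VG(2) by (subst bij_betw_cong[of _ _ f]) (auto simp: k_def)
  have kN: "bij_betw k ?N ?N'"
    using g VG(2) by (subst bij_betw_cong[of _ _ g]) (auto simp: k_def)
  have "bij_betw k (?M \<union> ?N) (?M' \<union> ?N')"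
    by (rule bij_betw_combine[OF kM kN]) auto
  moreover have "?M \<union> ?N = R" "?M' \<union> ?N' = S" by auto
  ultimately have kR: "bij_betw k R S" by simp
  have kd: "k d = c" by (simp add: k_def)
  have "bij_betw k (insert d R) (insert c S)"
    using notIn_Un_bij_betw[OF VG(2) _ kR] VF(2) kd by simp
  moreover have "(k u, k v) \<in> parcs F \<longleftrightarrow> (u, v) \<in> parcs G" if "u \<in> insert d R" "v \<in> insert d R" for u v
  proof -
    have R_in: "k w \<in> S" if "w \<in> R" for w using kR that by (auto simp: bij_betw_def)
    have adj: "(c, k w) \<in> parcs F \<longleftrightarrow> (d, w) \<in> parcs G" if "w \<in> R" for w
      using kM kN that by (auto simp: bij_betw_def)
    have sym: "(k w, c) \<in> parcs F \<longleftrightarrow> (c, k w) \<in> parcs F" "(w, d) \<in> parcs G \<longleftrightarrow> (d, w) \<in> parcs G" for w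
      using G.arcs_symmetric F.arcs_symmetric by blast+
    have "(c, c) \<notin> parcs F" "(d, d) \<notin> parcs G"
      by simp_all
    then show ?thesis
      using that adj sym R_in R(3) S kd by auto
  qed
  ultimately show thesis using that[of k] VF VG by simp
qed

text \<open>The empty graph has no vertex to remove, so it forms a case of its own, settled by the
  entry at 1.\<close>

lemma digraph_iso_iff_indep_vector_eq:
  assumes G: "pair_graph G" and F: "pair_graph F"
    and starlike: "pverts F = {} \<or> (\<exists>c\<in>pverts F. \<forall>u\<in>pverts F - {c}. \<forall>v\<in>pverts F - {c}. (u, v) \<notin> parcs F)"
  shows "digraph_iso (with_proj G) (with_proj F)
    \<longleftrightarrow> indep_vector G (pverts G) = indep_vector F (pverts F)" (is "?iso \<longleftrightarrow> ?eq")
proof -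
  interpret G: pair_graph G by fact
  interpret F: pair_graph F by fact
  have iso: "?iso \<longleftrightarrow> (\<exists>f. bij_betw f (pverts G) (pverts F) \<and>
    (\<forall>u\<in>pverts G. \<forall>v\<in>pverts G. (f u, f v) \<in> parcs F \<longleftrightarrow> (u, v) \<in> parcs G))"
    by (rule digraph_iso_with_proj_iff) unfold_locales
  show ?thesis
  proof
    assume ?iso
    then show ?eq using iso indep_vector_eq_if_iso by metis
  next
    assume eq: ?eq
    show ?iso
    proof (cases "pverts F = {}")
      case True
      then have "pverts G = {}"
        using fun_cong[OF eq, of 1] G.indep_vector_1[OF G.pair_finite_verts]
          F.indep_vector_1[OF F.pair_finite_verts] G.pair_finite_verts by simp
      then show ?thesis using True by (simp add: iso bij_betw_def)
    next
      case False
      then obtain c where "c \<in> pverts F" "\<forall>u\<in>pverts F - {c}. \<forall>v\<in>pverts F - {c}. (u, v) \<notin> parcs F"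
        using starlike by blast
      then show ?thesis
        unfolding iso using iso_if_indep_vector_eq[OF G F eq, of c "pverts F - {c}"]
        by (metis Diff_iff insert_Diff insertI1)
    qed
  qed
qed

section \<open>Stars with isolated vertices\<close>

lemma pair_graph_star_plus_edgeless:
  "pair_graph (disjoint_union (star_graph h) (edgeless_graph k))"
proof -
  have "finite {(u, v). u < h \<and> v < h \<and> u \<noteq> v \<and> (u = 0 \<or> v = 0)}"
    by (rule finite_subset[of _ "{..<h} \<times> {..<h}"]) auto
  then show ?thesis
    by unfold_locales
      (auto simp: disjoint_union_def star_graph_def edgeless_graph_def symmetric_def intro!: symI)
qed

theorem theorem1p6:
  fixes G :: "'a pair_pre_digraph" and H :: "'b pair_pre_digraph" and h k :: nat
  assumes "pair_graph G" and "pair_graph H"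
    and "kromatic G = kromatic H"
  shows "num_induced_copies (disjoint_union (star_graph h) (edgeless_graph k)) G
       = num_induced_copies (disjoint_union (star_graph h) (edgeless_graph k)) H"
proof -
  let ?F = "disjoint_union (star_graph h) (edgeless_graph k)"
  have starlike: "pverts ?F = {} \<or>
    (\<exists>c\<in>pverts ?F. \<forall>u\<in>pverts ?F - {c}. \<forall>v\<in>pverts ?F - {c}. (u, v) \<notin> parcs ?F)"
  \<comment> \<open>For \<open>h = 0\<close> there is no centre, but the graph has no edges, so it
    is empty or any vertex may be removed. Otherwise the centre \<open>Inl 0\<close> meets every
    edge.\<close>
  proof (cases "h = 0")
    case True
    then show ?thesis
      by (auto simp: disjoint_union_def star_graph_def edgeless_graph_def)
  next
    case False
    then show ?thesis
      by (intro disjI2 bexI[of _ "Inl 0"])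
        (auto simp: disjoint_union_def star_graph_def edgeless_graph_def)
  qed
  \<comment> \<open>The vertex type is generic because \<open>G\<close> and \<open>H\<close> may
    live on different types.\<close>
  have iso: "digraph_iso (with_proj (induced K U)) (with_proj ?F)
      \<longleftrightarrow> indep_vector K U = indep_vector ?F (pverts ?F)"
    if "pair_graph K" "U \<subseteq> pverts K" for K :: "'c pair_pre_digraph" and U
    using digraph_iso_iff_indep_vector_eq[OF pair_graph_induced[OF that]
        pair_graph_star_plus_edgeless starlike] by simp
  have copies: "num_induced_copies ?F K = card {U. U \<subseteq> pverts K \<and> indep_vector K U = indep_vector ?F (pverts ?F)}"
    if "pair_graph K" for K :: "'c pair_pre_digraph"
    unfolding num_induced_copies_eq[OF that] using iso[OF that] by (intro arg_cong[where f = card]) auto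
  show ?thesis
    unfolding copies[OF assms(1)] copies[OF assms(2)] by (rule card_indep_vector_fiber_eq[OF assms])
qed

end
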